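(* Let $P:\mathbb{E}\to(-\infty,+\infty]$ be proper closed convex and let $f:\mathbb{E}\to\mathbb{R}$ be convex and continuously differentiable with $\|\nabla f(\bm{x})-\nabla f(\bm{y})\|\le L\|\bm{x}-\bm{y}\|$ for all $\bm{x},\bm{y}\in\mathbb{E}$, where $L>0$. Put $F=P+f$, suppose the set of minimizers of $F$ over $\mathbb{E}$ is nonempty, and let $F^*=\min_{\bm{x}\in\mathbb{E}}F(\bm{x})$. Let $\theta_{-1}=\theta_0=1$ and $\theta_k=\frac{\alpha-1}{k+\alpha-1}$ for all $k\ge1$, with $\alpha>3$, and suppose $\sum_{k=0}^\infty\theta_k^{-1}\eta_k<\infty$, $\sum_{k=0}^\infty\theta_k^{-1}\mu_k<\infty$ and $\sum_{k=0}^\infty\theta_k^{-2}\nu_k<\infty$. Let $\{\bm{x}^k\}$ and $\{\widetilde{\bm{x}}^k\}$ be sequences generated by the SpinAPG algorithm (described in the context) with these parameters and tolerances. Then: (i) $\lim_{k\to\infty}k^2\big(F(\widetilde{\bm{x}}^k)-F^*\big)=0$ and $\lim_{k\to\infty}k\|\bm{x}^k-\bm{x}^{k-1}\|=0$; that is, $F(\widetilde{\bm{x}}^k)-F^*=o(1/k^2)$ and $\|\bm{x}^k-\bm{x}^{k-1}\|=o(1/k)$. (ii) Both sequences $\{\bm{x}^k\}$ and $\{\widetilde{\bm{x}}^k\}$ are bounded, and any cluster point of $\{\bm{x}^k\}$ or of $\{\widetilde{\bm{x}}^k\}$ is a minimizer of $F$ over $\mathbb{E}$. (iii) $\{\bm{x}^k\}$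 and $\{\widetilde{\bm{x}}^k\}$ converge to the same minimizer of $F$ over $\mathbb{E}$.
   Context: $\mathbb{E}$ is a real finite-dimensional Euclidean space with inner product $\langle\cdot,\cdot\rangle$ and induced norm $\|\cdot\|$. For $\varepsilon\ge0$ and $\bm{x}\in\mathrm{dom}\,P$, the $\varepsilon$-subdifferential is $\partial_\varepsilon P(\bm{x})=\{\bm{d}\in\mathbb{E}: P(\bm{y})\ge P(\bm{x})+\langle\bm{d},\bm{y}-\bm{x}\rangle-\varepsilon\ \ \forall\,\bm{y}\in\mathbb{E}\}$. SpinAPG. Let $\{\eta_k\}_{k\ge0},\{\mu_k\}_{k\ge0},\{\nu_k\}_{k\ge0}$ be sequences of nonnegative scalars and let $\bm{x}^{-1}=\bm{x}^0\in\mathbb{E}$ be arbitrary. For each $k=0,1,2,\dots$: set $\bm{y}^k=\bm{x}^k+\theta_k(\theta_{k-1}^{-1}-1)(\bm{x}^k-\bm{x}^{k-1})$; then find $\bm{x}^{k+1}\in\mathbb{E}$, $\widetilde{\bm{x}}^{k+1}\in\mathrm{dom}\,P$, $\Delta^k\in\mathbb{E}$ and $\varepsilon_k\ge0$ such that $$\Delta^k\in\partial_{\varepsilon_k}P(\widetilde{\bm{x}}^{k+1})+\nabla f(\bm{y}^k)+L(\bm{x}^{k+1}-\bm{y}^k),\quad \|\Delta^k\|\le\eta_k,\quad \varepsilon_k\le\nu_k,\quad \|\widetilde{\bm{x}}^{k+1}-\bm{x}^{k+1}\|\le\mu_k.$$ Here $L$ is the Lipschitz constant of $\nabla f$. Any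 infinite sequences satisfying these relations are "generated by SpinAPG". By convention $\widetilde{\bm{x}}^0\in\mathrm{dom}\,P$ is arbitrary. *)

theory Defs
  imports "HOL-Analysis.Analysis"
begin

text \<open>Functions with values in \<open>(-\<infinity>, +\<infinity>]\<close> are modelled as \<open>ereal\<close>-valued functions;
  properness excludes the value \<open>-\<infinity>\<close>.\<close>

definition effective_domain :: "('a \<Rightarrow> ereal) \<Rightarrow> 'a set" where
  "effective_domain P = {x. P x < \<infinity>}"

definition proper_fun :: "('a \<Rightarrow> ereal) \<Rightarrow> bool" where
  "proper_fun P \<longleftrightarrow> (\<forall>x. P x \<noteq> -\<infinity>) \<and> effective_domain P \<noteq> {}"

definition ereal_epigraph :: "('a \<Rightarrow> ereal) \<Rightarrow> ('a \<times> real) set" where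
  "ereal_epigraph P = {(x, r). P x \<le> ereal r}"

definition closed_fun :: "('a::topological_space \<Rightarrow> ereal) \<Rightarrow> bool" where
  "closed_fun P \<longleftrightarrow> closed (ereal_epigraph P)"

definition convex_fun :: "('a::real_vector \<Rightarrow> ereal) \<Rightarrow> bool" where
  "convex_fun P \<longleftrightarrow> convex (ereal_epigraph P)"

definition eps_subdifferential :: "('a::real_inner \<Rightarrow> ereal) \<Rightarrow> real \<Rightarrow> 'a \<Rightarrow> 'a set" where
  "eps_subdifferential P \<epsilon> x =
     {d. \<forall>y. P y \<ge> P x + ereal (d \<bullet> (y - x)) - ereal \<epsilon>}"

definition minimizers :: "('a \<Rightarrow> ereal) \<Rightarrow> 'a set" where
  "minimizers F = {x. is_arg_min F (\<lambda>_. True) x}"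

definition cluster_point :: "(nat \<Rightarrow> 'a::topological_space) \<Rightarrow> 'a \<Rightarrow> bool" where
  "cluster_point X z \<longleftrightarrow> (\<exists>r::nat \<Rightarrow> nat. strict_mono r \<and> (X \<circ> r) \<longlonglongrightarrow> z)"

text \<open>The conventions \<open>x\<^sup>-\<^sup>1 = x\<^sup>0\<close> and \<open>\<theta>\<^sub>-\<^sub>1 = \<theta>\<^sub>0\<close> are encoded by truncated
  subtraction on the natural numbers: at \<open>k = 0\<close> the index \<open>k - 1\<close> is \<open>0\<close>.
  The argument \<open>g\<close> is the gradient of the smooth part, and \<open>xt\<close> is the sequence of
  the points written with a tilde.\<close>

definition spinapg_generated ::
  "('a::real_inner \<Rightarrow> ereal) \<Rightarrow> ('a \<Rightarrow> 'a) \<Rightarrow> real \<Rightarrow> (nat \<Rightarrow> real) \<Rightarrow>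
   (nat \<Rightarrow> real) \<Rightarrow> (nat \<Rightarrow> real) \<Rightarrow> (nat \<Rightarrow> real) \<Rightarrow> (nat \<Rightarrow> 'a) \<Rightarrow> (nat \<Rightarrow> 'a) \<Rightarrow> bool" where
  "spinapg_generated P g L \<theta> \<eta> \<mu> \<nu> x xt \<longleftrightarrow>
     (\<forall>k. \<eta> k \<ge> 0 \<and> \<mu> k \<ge> 0 \<and> \<nu> k \<ge> 0) \<and>
     xt 0 \<in> effective_domain P \<and>
     (\<exists>y \<Delta> \<epsilon>. \<forall>k.
        y k = x k + (\<theta> k * (inverse (\<theta> (k - 1)) - 1)) *\<^sub>R (x k - x (k - 1)) \<and>
        xt (Suc k) \<in> effective_domain P \<and>
        \<epsilon> k \<ge> 0 \<and>
        \<Delta> k \<in> (\<lambda>d. d + g (y k) + L *\<^sub>R (x (Suc k) - y k)) `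
                 eps_subdifferential P (\<epsilon> k) (xt (Suc k)) \<and>
        norm (\<Delta> k) \<le> \<eta> k \<and>
        \<epsilon> k \<le> \<nu> k \<and>
        norm (xt (Suc k) - x (Suc k)) \<le> \<mu> k)"

end

theory Submission
  imports Defs
begin

text \<open>Write \<open>a = \<alpha> - 1\<close>, \<open>\<theta>\<^sub>k = a / (k + a)\<close>, \<open>e\<^sub>k\<close> for the error \<open>xt k - x k\<close>,
  \<open>d\<^sub>k = x k - x (k - 1)\<close> and \<open>u\<^sub>k = x k + ((k - 1) / a) d\<^sub>k\<close>.
  One inexact proximal step satisfies, for every \<open>z\<close> in the domain,
  \<open>F (xt (k+1)) - F z \<le> L/2 (|z - y\<^sub>k|\<^sup>2 - |z - x (k+1)|\<^sup>2) + errors\<close>.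
  With \<open>z = (1 - \<theta>\<^sub>k) xt k + \<theta>\<^sub>k x\<^sup>*\<close> this makes
  \<open>((k - 1 + a)/a)\<^sup>2 (F (xt k) - F\<^sup>*) + L/2 |u\<^sub>k - x\<^sup>*|\<^sup>2\<close> decreasing up to summable terms; since
  \<open>a > 2\<close> the decrease also gives \<open>\<Sum> k (F (xt k) - F\<^sup>*) < \<infinity>\<close>. With \<open>z = xt k\<close> and the weight
  \<open>(k + a)\<^sup>2\<close> it shows that \<open>(k + a - 1)\<^sup>2 (F (xt k) - F\<^sup>* + L/2 |d\<^sub>k|\<^sup>2)\<close> converges and is summable
  against \<open>1/k\<close>, so its limit is zero. Hence \<open>u\<^sub>k - x k\<close> tends to zero, the distance of
  \<open>x k\<close> to each minimizer converges, and Opial's argument applies.\<close>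

section \<open>Summability and limits of real sequences\<close>

text \<open>Subtracting the partial sums of \<open>s\<close> from \<open>E\<close> gives a
  decreasing sequence bounded below by \<open>- suminf s\<close>. Telescoping the same inequality
  bounds the partial sums of \<open>r\<close>.\<close>

lemma convergent_quasi_decreasing:
  fixes E r s :: "nat \<Rightarrow> real"
  assumes step: "\<And>k. E (Suc k) + r k \<le> E k + s k"
    and "\<And>k. E k \<ge> 0" "\<And>k. r k \<ge> 0" "\<And>k. s k \<ge> 0" "summable s"
  shows "convergent E" "summable r"
proof -
  have part: "sum s {..<n} \<le> suminf s" for n
    using assms by (intro sum_le_suminf) auto
  have tot: "E n + sum r {..<n} \<le> E 0 + sum s {..<n}" for n
  proof (induction n)
    case (Suc n)
    then show ?case using step[of n] by simp
  qed simp
  have "sum r {..<n} \<le> E 0 + suminf s" for n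
    using tot[of n] part[of n] assms(2)[of n] by linarith
  then show "summable r"
    using assms(3) by (intro summableI_nonneg_bounded[where x = "E 0 + suminf s"]) auto
  define H where "H n = E n - sum s {..<n}" for n
  have H: "H (Suc n) \<le> H n" for n
    using step[of n] assms(3)[of n] by (simp add: H_def)
  then have "decseq H"
    by (simp add: decseq_SucI)
  moreover have "- suminf s \<le> H n" for n
    using part[of n] assms(2)[of n] by (simp add: H_def)
  ultimately obtain l where "H \<longlonglongrightarrow> l"
    by (metis decseq_convergent)
  moreover have "(\<lambda>n. sum s {..<n}) \<longlonglongrightarrow> suminf s"
    using \<open>summable s\<close> by (rule summable_LIMSEQ)
  ultimately have "(\<lambda>n. H n + sum s {..<n}) \<longlonglongrightarrow> l + suminf s"
    by (rule tendsto_add)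
  then show "convergent E"
    by (auto simp: H_def convergent_def)
qed

text \<open>At an index \<open>m \<le> N\<close> where \<open>w\<close> is maximal, the energy bound is quadratic in \<open>w m\<close> on the
  left and only linear on the right, with constants independent of \<open>N\<close>.\<close>

lemma bounded_quadratic_energy:
  fixes E w p q s :: "nat \<Rightarrow> real"
  assumes step: "\<And>k. E (Suc k) \<le> E k + p k * w (Suc k) + q k * w k + s k"
    and c: "c > 0" and E: "\<And>k. c * (w k)\<^sup>2 \<le> E k"
    and nonneg: "\<And>k. w k \<ge> 0" "\<And>k. p k \<ge> 0" "\<And>k. q k \<ge> 0" "\<And>k. s k \<ge> 0"
    and summ: "summable p" "summable q" "summable s"
  shows "\<exists>M. \<forall>k. w k \<le> M"
proof -
  define A B C where "A = suminf p" and "B = suminf q" and "C = suminf s"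
  have part: "sum p {..<n} \<le> A" "sum q {..<n} \<le> B" "sum s {..<n} \<le> C" for n
    unfolding A_def B_def C_def using nonneg summ by (auto intro!: sum_le_suminf)
  have ABC: "A \<ge> 0" "B \<ge> 0" "C \<ge> 0"
    using part[of 0] by simp_all
  have E0: "E 0 \<ge> 0"
    using E[of 0] c by (smt (verit) mult_nonneg_nonneg zero_le_power2)
  have "w N \<le> max 1 ((E 0 + A + B + C) / c)" for N
  proof -
    define M where "M = Max (w ` {..N})"
    have M: "w k \<le> M" if "k \<le> N" for k
      using that by (simp add: M_def)
    have "M \<in> w ` {..N}"
      unfolding M_def by (intro Max_in) auto
    then obtain m where m: "m \<le> N" "w m = M"
      by auto
    have M0: "M \<ge> 0"
      using nonneg(1)[of m] m by simp
    have "E n \<le> E 0 + (sum p {..<n} + sum q {..<n}) * M + sum s {..<n}" if "n \<le> N" for n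
      using that
    proof (induction n)
      case (Suc n)
      have "p n * w (Suc n) \<le> p n * M" "q n * w n \<le> q n * M"
        using Suc.prems nonneg M by (auto intro!: mult_left_mono)
      then show ?case
        using Suc step[of n] by (simp add: algebra_simps)
    qed simp
    from this[OF m(1)] have "c * M\<^sup>2 \<le> E 0 + (sum p {..<m} + sum q {..<m}) * M + sum s {..<m}"
      using E[of m] m(2) by simp
    also have "\<dots> \<le> E 0 + (A + B) * M + C"
      using part[of m] M0 by (intro add_mono mult_right_mono) auto
    finally have quad: "c * M\<^sup>2 \<le> E 0 + (A + B) * M + C" .
    have "M \<le> max 1 ((E 0 + A + B + C) / c)"
    proof (cases "M \<le> 1")
      case False
      \<comment> \<open>Once \<open>M > 1\<close>, the constant term is absorbed into the linear
        one, and dividing by \<open>M\<close> bounds \<open>c * M\<close>.\<close>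
      have "E 0 + C \<le> (E 0 + C) * M"
        using False E0 ABC by (simp add: mult_le_cancel_left1)
      with quad have "M * (c * M) \<le> M * (E 0 + A + B + C)"
        by (simp add: algebra_simps power2_eq_square)
      then have "c * M \<le> E 0 + A + B + C"
        using False by simp
      then have "M \<le> (E 0 + A + B + C) / c"
        using c by (simp add: field_simps)
      then show ?thesis by simp
    qed simp
    then show ?thesis
      using M[of N] by simp
  qed
  then show ?thesis by blast
qed

lemma summable_mult_nonneg:
  fixes f h :: "nat \<Rightarrow> real"
  assumes "summable f" "summable h" "\<And>k. f k \<ge> 0" "\<And>k. h k \<ge> 0"
  shows "summable (\<lambda>k. f k * h k)"
proof -
  have "Bseq f"
    by (intro convergent_imp_Bseq convergentI[of _ 0] summable_LIMSEQ_zero assms(1))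
  then obtain K where "\<And>k. norm (f k) \<le> K"
    by (auto simp: Bseq_def)
  then have K: "f k \<le> K" for k
    by (simp add: abs_le_iff)
  show ?thesis
  proof (rule summable_comparison_test')
    show "summable (\<lambda>k. K * h k)"
      using assms(2) by (rule summable_mult)
    show "norm (f k * h k) \<le> K * h k" for k
      using K[of k] assms(3,4)[of k] by (simp add: abs_mult mult_right_mono)
  qed
qed

text \<open>A positive limit would make the series dominate a multiple of the harmonic series. This
  is what turns O-rates into o-rates.\<close>

lemma tendsto_zero_if_summable_div:
  fixes G :: "nat \<Rightarrow> real"
  assumes "convergent G" and "\<And>k. G k \<ge> 0" and "summable (\<lambda>k. G k / (real k + 1))"
  shows "G \<longlonglongrightarrow> 0"
proof -
  obtain l where l: "G \<longlonglongrightarrow> l"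
    using assms(1) by (auto simp: convergent_def)
  have "l \<ge> 0"
    using l assms(2) by (simp add: LIMSEQ_le_const)
  have "l = 0"
  proof (rule ccontr)
    assume "l \<noteq> 0"
    with \<open>l \<ge> 0\<close> have "l / 2 < l" "l > 0" by auto
    from order_tendstoD(1)[OF l this(1)] obtain N where N: "l / 2 < G n" if "n \<ge> N" for n
      unfolding eventually_sequentially by blast
    have "summable (\<lambda>k. (l / 2) * (1 / (real k + 1)))"
    proof (rule summable_comparison_test'[OF assms(3), of N])
      fix n assume "n \<ge> N"
      then have "l / 2 \<le> G n"
        using N by (simp add: less_imp_le)
      then have "(l / 2) / (real n + 1) \<le> G n / (real n + 1)"
        by (rule divide_right_mono) simp
      then show "norm ((l / 2) * (1 / (real n + 1))) \<le> G n / (real n + 1)"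
        using \<open>l > 0\<close> by simp
    qed
    then have "summable (\<lambda>k. 1 / (real k + 1))"
      by (rule summable_mult_D) (use \<open>l > 0\<close> in simp)
    then have "summable (\<lambda>k. inverse (real (Suc k)))"
      by (simp add: inverse_eq_divide add.commute)
    then show False
      using not_summable_harmonic[where ?'a = real] summable_Suc_iff[of "\<lambda>k. inverse (real k)"]
      by blast
  qed
  with l show ?thesis by simp
qed

lemma tendsto_zero_squeeze:
  fixes f h :: "nat \<Rightarrow> real"
  assumes "\<And>k. 0 \<le> f k" "\<And>k. f k \<le> h k" "h \<longlonglongrightarrow> 0"
  shows "f \<longlonglongrightarrow> 0"
  using assms by (intro tendsto_sandwich[of "\<lambda>_. 0" f _ h 0]) auto

section \<open>First-order bounds for smooth convex functions\<close>

lemma gderiv_along_line: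
  fixes f :: "'a::real_inner \<Rightarrow> real"
  assumes "GDERIV f (y + t *\<^sub>R d) :> gy"
  shows "((\<lambda>t. f (y + t *\<^sub>R d)) has_field_derivative (gy \<bullet> d)) (at t)"
proof -
  have lin: "((\<lambda>t. y + t *\<^sub>R d) has_derivative (\<lambda>t. t *\<^sub>R d)) (at t)"
    by (auto intro!: derivative_eq_intros)
  have "((\<lambda>t. f (y + t *\<^sub>R d)) has_derivative (\<lambda>s. (s *\<^sub>R d) \<bullet> gy)) (at t)"
    using has_derivative_compose[OF lin, of f "\<lambda>h. h \<bullet> gy"] assms by (simp add: gderiv_def)
  moreover have "(\<lambda>s. (s *\<^sub>R d) \<bullet> gy) = (*) (gy \<bullet> d)"
    by (auto simp: inner_commute)
  ultimately show ?thesis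
    by (simp add: has_field_derivative_def)
qed

lemma convex_above_gradient:
  fixes f :: "'a::real_inner \<Rightarrow> real"
  assumes "convex_on UNIV f" and "GDERIV f y :> gy"
  shows "f z \<ge> f y + gy \<bullet> (z - y)"
proof -
  have "((\<lambda>t. f (y + t *\<^sub>R (z - y))) has_field_derivative (gy \<bullet> (z - y))) (at 0)"
    using assms(2) by (intro gderiv_along_line) simp
  moreover have "convex_on UNIV (\<lambda>t. f (y + t *\<^sub>R (z - y)))"
  proof (rule convex_onI)
    fix t a b :: real assume t: "0 < t" "t < 1"
    have "y + ((1 - t) *\<^sub>R a + t *\<^sub>R b) *\<^sub>R (z - y) =
        (1 - t) *\<^sub>R (y + a *\<^sub>R (z - y)) + t *\<^sub>R (y + b *\<^sub>R (z - y))"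
      by (simp add: algebra_simps)
    then show "f (y + ((1 - t) *\<^sub>R a + t *\<^sub>R b) *\<^sub>R (z - y)) \<le>
        (1 - t) * f (y + a *\<^sub>R (z - y)) + t * f (y + b *\<^sub>R (z - y))"
      using convex_onD[OF assms(1), of t] t by simp
  qed simp
  ultimately show ?thesis
    using convex_on_imp_above_tangent[of UNIV "\<lambda>t. f (y + t *\<^sub>R (z - y))" 0 1 "gy \<bullet> (z - y)"]
    by simp
qed

text \<open>Along the segment from \<open>y\<close> to \<open>z\<close>, the difference between
  \<open>f\<close> and its quadratic model has nonpositive derivative, by Cauchy-Schwarz and the
  Lipschitz bound.\<close>

lemma descent_lemma:
  fixes f :: "'a::real_inner \<Rightarrow> real"
  assumes der: "\<And>z. GDERIV f z :> g z" and lip: "\<And>u v. norm (g u - g v) \<le> L * norm (u - v)"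
  shows "f z \<le> f y + g y \<bullet> (z - y) + L / 2 * (norm (z - y))\<^sup>2"
proof -
  define d where "d = z - y"
  define h where "h t = f (y + t *\<^sub>R d) - t * (g y \<bullet> d) - L / 2 * t\<^sup>2 * (norm d)\<^sup>2" for t
  have "h 1 \<le> h 0"
  proof (rule DERIV_nonpos_imp_nonincreasing[of 0 1 h])
    fix t :: real assume t: "0 \<le> t" "t \<le> 1"
    note [derivative_intros] = gderiv_along_line[OF der, where y = y and d = d]
    have "DERIV h t :> g (y + t *\<^sub>R d) \<bullet> d - g y \<bullet> d - L * t * (norm d)\<^sup>2"
      unfolding h_def by (auto intro!: derivative_eq_intros)
    moreover have "(g (y + t *\<^sub>R d) - g y) \<bullet> d \<le> L * t * (norm d)\<^sup>2"
    proof -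
      have "(g (y + t *\<^sub>R d) - g y) \<bullet> d \<le> norm (g (y + t *\<^sub>R d) - g y) * norm d"
        by (rule norm_cauchy_schwarz)
      also have "\<dots> \<le> (L * norm (t *\<^sub>R d)) * norm d"
        using lip[of "y + t *\<^sub>R d" y] by (intro mult_right_mono) auto
      finally show ?thesis
        using t by (simp add: power2_eq_square mult.assoc)
    qed
    ultimately show "\<exists>D. DERIV h t :> D \<and> D \<le> 0"
      by (intro exI conjI) (auto simp: inner_diff_left)
  qed simp
  then show ?thesis
    by (simp add: h_def d_def)
qed

lemma norm_diff_sq:
  fixes v w :: "'a::real_inner"
  shows "(norm (v - w))\<^sup>2 = (norm v)\<^sup>2 - 2 * (v \<bullet> w) + (norm w)\<^sup>2"
  by (simp add: power2_norm_eq_inner inner_diff_left inner_diff_right inner_commute)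

lemma norm_inner_le_sum3:
  fixes p q r w :: "'a::real_inner"
  shows "w \<bullet> (p + q - r) \<le> norm w * (norm p + norm q + norm r)"
proof -
  have "w \<bullet> (p + q - r) \<le> norm w * norm (p + q - r)"
    by (rule norm_cauchy_schwarz)
  also have "norm (p + q - r) \<le> norm p + norm q + norm r"
    by (meson add_right_mono norm_triangle_ineq norm_triangle_ineq4 order_trans)
  finally show ?thesis
    by (simp add: mult_left_mono)
qed

section \<open>The abstract inexact accelerated scheme\<close>

text \<open>Subdifferentials and gradients are hidden behind \<open>descent\<close>, the only
  property of a step that the analysis uses. The extrapolation coefficient is \<theta>_k
  (1/\<theta>_{k-1} - 1) written out, and \<open>real k + a\<close> is a multiple of
  1/\<theta>_k.\<close>

locale inexact_apg =
  fixes \<phi> :: "'a::euclidean_space \<Rightarrow> real" and D :: "'a set" and L a :: real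
    and \<epsilon> :: "nat \<Rightarrow> real" and \<Delta> x xt y :: "nat \<Rightarrow> 'a"
  assumes convex: "convex_on D \<phi>"
    and L_pos: "L > 0"
    and a_gt: "a > 2"
    and xt_mem: "xt k \<in> D"
    and \<epsilon>_nonneg: "\<epsilon> k \<ge> 0"
    and extrapolation: "y k = x k + ((real k - 1) / (real k + a)) *\<^sub>R (x k - x (k - 1))"
    and descent: "z \<in> D \<Longrightarrow> \<phi> (xt (Suc k)) - \<phi> z \<le>
      L / 2 * ((norm (z - y k))\<^sup>2 - (norm (z - x (Suc k)))\<^sup>2) + \<Delta> k \<bullet> (xt (Suc k) - z)
        + L / 2 * (norm (xt (Suc k) - x (Suc k)))\<^sup>2 + \<epsilon> k"
    and summable_\<Delta>: "summable (\<lambda>k. (real k + a) * norm (\<Delta> k))"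
    and summable_xt: "summable (\<lambda>k. (real k + a) * norm (xt k - x k))"
    and summable_\<epsilon>: "summable (\<lambda>k. (real k + a)\<^sup>2 * \<epsilon> k)"
begin

definition "e k = xt k - x k"
definition "d k = x k - x (k - 1)"
definition "u k = x k + ((real k - 1) / a) *\<^sub>R d k"

text \<open>Collects the errors that involve neither the velocity nor \<open>u\<close>. The velocity
  estimate uses this weight as it is, the energy estimate after division by
  \<open>a\<^sup>2\<close>.\<close>

definition "err k = (real k + a)\<^sup>2 *
  (norm (\<Delta> k) * (norm (e (Suc k)) + norm (e k)) + L / 2 * (norm (e (Suc k)))\<^sup>2 + \<epsilon> k)"

lemma err_nonneg: "err k \<ge> 0"
  using L_pos \<epsilon>_nonneg[of k] by (simp add: err_def)

lemma summable_e: "summable (\<lambda>k. (real k + a) * norm (e k))"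
  using summable_xt by (simp add: e_def)

lemma summable_err: "summable err"
proof -
  have S: "summable (\<lambda>k. (real (Suc k) + a) * norm (e (Suc k)))"
    using summable_e by (subst summable_Suc_iff)
  have S': "summable (\<lambda>k. (real k + a) * norm (e (Suc k)))"
    by (rule summable_comparison_test'[OF S, of 0]) (use a_gt in \<open>simp add: mult_right_mono\<close>)
  \<comment> \<open>The squared weight is split evenly between the two factors of each product of
    errors, making both factors summable.\<close>
  have "summable (\<lambda>k. ((real k + a) * norm (\<Delta> k)) * ((real k + a) * norm (e (Suc k)))
      + ((real k + a) * norm (\<Delta> k)) * ((real k + a) * norm (e k))
      + L / 2 * (((real k + a) * norm (e (Suc k))) * ((real k + a) * norm (e (Suc k))))
      + (real k + a)\<^sup>2 * \<epsilon> k)"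
    using a_gt
    by (intro summable_add summable_mult_nonneg summable_mult summable_\<Delta> S' summable_e summable_\<epsilon>) auto
  then show ?thesis
    by (rule back_subst[of summable]) (auto simp: err_def power2_eq_square algebra_simps)
qed

text \<open>Read backwards, \<open>x (Suc k)\<close> is the convex combination of \<open>x k\<close>
  and \<open>u (Suc k)\<close> in which \<open>u (Suc k)\<close> has weight \<theta>_k.\<close>

lemma u_Suc: "u (Suc k) = x k + ((real k + a) / a) *\<^sub>R d (Suc k)"
proof -
  have "(real k + a) / a = 1 + real k / a"
    using a_gt by (simp add: field_simps)
  then show ?thesis
    by (simp add: u_def d_def algebra_simps)
qed

section \<open>Energy relative to a minimizer\<close>

text \<open>The first factor is the square of 1/\<theta>_{k-1}. At index 0 the same formula is kept
  instead of the convention \<theta>_{-1} = 1, so the step estimate needs no case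
  distinction.\<close>

definition "E z k = ((real k - 1 + a) / a)\<^sup>2 * (\<phi> (xt k) - \<phi> z) + L / 2 * (norm (u k - z))\<^sup>2"

text \<open>These coefficients multiply the distances of \<open>u (Suc k)\<close> and
  \<open>u k\<close> from \<open>z\<close>. They are kept apart from \<open>err\<close> because
  those distances are not yet known to be bounded.\<close>

definition "p k = L / a * ((real k + a) * norm (e k)) + (real k + a) * norm (\<Delta> k) / a"
definition "q k = L / a * ((real k + a) * norm (e k))"

lemma energy_step:
  assumes z: "z \<in> D" and z_le: "\<phi> z \<le> \<phi> (xt k)"
  shows "E z (Suc k) + (a - 2) / a\<^sup>2 * (real k * (\<phi> (xt k) - \<phi> z))
    \<le> E z k + p k * norm (u (Suc k) - z) + q k * norm (u k - z) + err k / a\<^sup>2"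
proof -
  \<comment> \<open>\<open>t\<close> is \<theta>_k and \<open>c\<close> is its inverse.\<close>
  define t where "t = a / (real k + a)"
  define c where "c = (real k + a) / a"
  have a0: "a > 0" and ka: "real k + a > 0"
    using a_gt by auto
  have ct: "c * t = 1"
    using a0 ka by (simp add: c_def t_def)
  have t01: "0 \<le> t" "t \<le> 1"
    using a0 ka by (auto simp: t_def)
  have "c * (1 - t) = c - 1"
    using ct by (simp add: right_diff_distrib)
  then have c1t: "c * (1 - t) = real k / a"
    using a0 by (simp add: c_def field_simps)
  define v v' w w' where "v = \<phi> (xt k) - \<phi> z" and "v' = \<phi> (xt (Suc k)) - \<phi> z"
    and "w = u k - z" and "w' = u (Suc k) - z"
  define \<zeta> where "\<zeta> = (1 - t) *\<^sub>R xt k + t *\<^sub>R z"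
  have \<zeta>: "\<zeta> \<in> D" "\<phi> \<zeta> \<le> (1 - t) * \<phi> (xt k) + t * \<phi> z"
    using convex xt_mem z t01 by (auto simp: convex_on_def \<zeta>_def convex_alt)
  have X': "x (Suc k) = x k + t *\<^sub>R (u (Suc k) - x k)"
    using a0 ka by (simp add: u_Suc t_def d_def)
  have Y: "y k = x k + t *\<^sub>R (u k - x k)"
    using a0 ka by (simp add: extrapolation u_def t_def d_def)
  have zy: "\<zeta> - y k = (1 - t) *\<^sub>R e k - t *\<^sub>R w"
    by (simp add: \<zeta>_def Y e_def w_def algebra_simps)
  have zx: "\<zeta> - x (Suc k) = (1 - t) *\<^sub>R e k - t *\<^sub>R w'"
    unfolding X' by (simp add: \<zeta>_def e_def w'_def algebra_simps)
  have xz: "xt (Suc k) - \<zeta> = e (Suc k) + t *\<^sub>R w' - (1 - t) *\<^sub>R e k"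
    using zx by (simp add: e_def algebra_simps)
  \<comment> \<open>Both vectors contain the same multiple of \<open>e k\<close>, whose square
    cancels; the error survives only in a cross term with \<open>w' - w\<close>.\<close>
  have sq: "(norm (\<zeta> - y k))\<^sup>2 - (norm (\<zeta> - x (Suc k)))\<^sup>2 =
      t\<^sup>2 * ((norm w)\<^sup>2 - (norm w')\<^sup>2) + 2 * t * (1 - t) * (e k \<bullet> (w' - w))"
    unfolding zy zx norm_diff_sq
    by (simp add: inner_diff_right power_mult_distrib power2_eq_square[of t] algebra_simps)
  have "v' \<le> (1 - t) * v + L / 2 * (t\<^sup>2 * ((norm w)\<^sup>2 - (norm w')\<^sup>2) + 2 * t * (1 - t) * (e k \<bullet> (w' - w)))
      + \<Delta> k \<bullet> (xt (Suc k) - \<zeta>) + (L / 2 * (norm (e (Suc k)))\<^sup>2 + \<epsilon> k)"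
    using descent[OF \<zeta>(1), of k] \<zeta>(2) unfolding sq
    by (simp add: v_def v'_def e_def algebra_simps)
  \<comment> \<open>Since \<open>c * t = 1\<close>, this factor gives the squared distances the
    constant weight \<open>L / 2\<close> that they have in \<open>E\<close>.\<close>
  then have "c\<^sup>2 * v' \<le> c\<^sup>2 * ((1 - t) * v + L / 2 * (t\<^sup>2 * ((norm w)\<^sup>2 - (norm w')\<^sup>2) + 2 * t * (1 - t) * (e k \<bullet> (w' - w)))
      + \<Delta> k \<bullet> (xt (Suc k) - \<zeta>) + (L / 2 * (norm (e (Suc k)))\<^sup>2 + \<epsilon> k))"
    by (rule mult_left_mono) simp
  also have "\<dots> = c * (c * (1 - t)) * v + L / 2 * ((c * t)\<^sup>2 * ((norm w)\<^sup>2 - (norm w')\<^sup>2))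
      + L * (c * t) * (c * (1 - t)) * (e k \<bullet> (w' - w))
      + c\<^sup>2 * (\<Delta> k \<bullet> (xt (Suc k) - \<zeta>)) + c\<^sup>2 * (L / 2 * (norm (e (Suc k)))\<^sup>2 + \<epsilon> k)"
    by (simp add: power2_eq_square algebra_simps)
  finally have main: "c\<^sup>2 * v' + L / 2 * (norm w')\<^sup>2 \<le> c * (real k / a) * v + L / 2 * (norm w)\<^sup>2
      + L * (real k / a) * (e k \<bullet> (w' - w))
      + c\<^sup>2 * (\<Delta> k \<bullet> (xt (Suc k) - \<zeta>)) + c\<^sup>2 * (L / 2 * (norm (e (Suc k)))\<^sup>2 + \<epsilon> k)"
    unfolding c1t ct by (simp add: right_diff_distrib)
  have b1: "L * (real k / a) * (e k \<bullet> (w' - w)) \<le> q k * (norm w' + norm w)"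
  proof -
    have "e k \<bullet> (w' - w) \<le> norm (e k) * norm (w' - w)"
      by (rule norm_cauchy_schwarz)
    also have "\<dots> \<le> norm (e k) * (norm w' + norm w)"
      by (intro mult_left_mono norm_triangle_ineq4) simp
    finally have "L * (real k / a) * (e k \<bullet> (w' - w)) \<le>
        L * (real k / a) * (norm (e k) * (norm w' + norm w))"
      using L_pos a0 by (intro mult_left_mono) auto
    also have "\<dots> \<le> L * ((real k + a) / a) * (norm (e k) * (norm w' + norm w))"
      using L_pos a0 by (intro mult_right_mono mult_left_mono divide_right_mono) auto
    finally show ?thesis
      by (simp add: q_def)
  qed
  have b2: "c\<^sup>2 * (\<Delta> k \<bullet> (xt (Suc k) - \<zeta>)) \<le>
      c\<^sup>2 * (norm (\<Delta> k) * (norm (e (Suc k)) + norm (e k))) + c * norm (\<Delta> k) * norm w'"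
  proof -
    have "\<Delta> k \<bullet> (xt (Suc k) - \<zeta>) \<le>
        norm (\<Delta> k) * (norm (e (Suc k)) + norm (t *\<^sub>R w') + norm ((1 - t) *\<^sub>R e k))"
      unfolding xz by (rule norm_inner_le_sum3)
    also have "\<dots> \<le> norm (\<Delta> k) * (norm (e (Suc k)) + t * norm w' + norm (e k))"
      using t01 by (intro mult_left_mono add_mono) (auto simp: mult_left_le_one_le)
    finally have "c\<^sup>2 * (\<Delta> k \<bullet> (xt (Suc k) - \<zeta>)) \<le>
        c\<^sup>2 * (norm (\<Delta> k) * (norm (e (Suc k)) + t * norm w' + norm (e k)))"
      by (rule mult_left_mono) simp
    also have "\<dots> = c\<^sup>2 * (norm (\<Delta> k) * (norm (e (Suc k)) + norm (e k)))
        + c * (c * t) * norm (\<Delta> k) * norm w'"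
      by (simp add: power2_eq_square algebra_simps)
    finally show ?thesis
      by (simp add: ct)
  qed
  have b3: "c * (real k / a) * v + (a - 2) / a\<^sup>2 * (real k * v) \<le> ((real k - 1 + a) / a)\<^sup>2 * v"
  proof -
    \<comment> \<open>After multiplication by \<open>a\<^sup>2\<close>: (k + a - 1)^2 - k (k + a) -
      (a - 2) k = (a - 1)^2. The decrease has the coefficient \<open>a - 2\<close>, which is
      positive because \<alpha> > 3.\<close>
    have "((real k - 1 + a) / a)\<^sup>2 - c * (real k / a) - (a - 2) / a\<^sup>2 * real k = ((a - 1) / a)\<^sup>2"
      using a0 by (simp add: c_def power2_eq_square field_simps)
    then have "c * (real k / a) + (a - 2) / a\<^sup>2 * real k \<le> ((real k - 1 + a) / a)\<^sup>2"
      by (smt (verit) zero_le_power2)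
    then have "(c * (real k / a) + (a - 2) / a\<^sup>2 * real k) * v \<le> ((real k - 1 + a) / a)\<^sup>2 * v"
      using z_le by (intro mult_right_mono) (simp_all add: v_def)
    then show ?thesis
      by (simp add: algebra_simps)
  qed
  have Es: "E z (Suc k) = c\<^sup>2 * v' + L / 2 * (norm w')\<^sup>2"
    by (simp add: E_def c_def v'_def w'_def)
  have Ek: "E z k = ((real k - 1 + a) / a)\<^sup>2 * v + L / 2 * (norm w)\<^sup>2"
    by (simp add: E_def v_def w_def)
  have er: "err k / a\<^sup>2 = c\<^sup>2 * (norm (\<Delta> k) * (norm (e (Suc k)) + norm (e k)))
      + c\<^sup>2 * (L / 2 * (norm (e (Suc k)))\<^sup>2 + \<epsilon> k)"
    unfolding err_def c_def power_divide by (simp add: distrib_left add_divide_distrib)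
  have pw: "p k * norm w' = q k * norm w' + c * norm (\<Delta> k) * norm w'"
    by (simp add: p_def q_def c_def distrib_right)
  show ?thesis
    using main b1 b2 b3 unfolding Es Ek er v_def[symmetric] w_def[symmetric] w'_def[symmetric] pw
    by (simp add: distrib_left)
qed

lemma p_nonneg: "p k \<ge> 0" and q_nonneg: "q k \<ge> 0"
  using L_pos a_gt by (auto simp: p_def q_def)

lemma summable_p: "summable p" and summable_q: "summable q"
proof -
  show "summable q"
    unfolding q_def by (intro summable_mult summable_e)
  then show "summable p"
    unfolding p_def q_def by (intro summable_add summable_divide summable_\<Delta>)
qed

lemma E_ge:
  assumes "\<phi> z \<le> \<phi> (xt k)"
  shows "L / 2 * (norm (u k - z))\<^sup>2 \<le> E z k"
  using assms by (simp add: E_def)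

text \<open>Here the decrease of the energy is discarded; the errors linear in the unknown distances
  are absorbed by the quadratic term of the energy.\<close>

lemma bounded_u:
  assumes z: "z \<in> D" and z_min: "\<And>w. w \<in> D \<Longrightarrow> \<phi> z \<le> \<phi> w"
  shows "\<exists>M. \<forall>k. norm (u k - z) \<le> M"
proof (rule bounded_quadratic_energy)
  have le: "\<phi> z \<le> \<phi> (xt k)" for k
    by (rule z_min[OF xt_mem])
  show "E z (Suc k) \<le> E z k + p k * norm (u (Suc k) - z) + q k * norm (u k - z) + err k / a\<^sup>2" for k
  proof -
    have "(a - 2) / a\<^sup>2 * (real k * (\<phi> (xt k) - \<phi> z)) \<ge> 0"
      using a_gt le[of k] by simp
    then show ?thesis
      using energy_step[OF z le[of k]] by linarith
  qed
  show "L / 2 * (norm (u k - z))\<^sup>2 \<le> E z k" for k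
    by (rule E_ge[OF le])
  show "summable (\<lambda>k. err k / a\<^sup>2)"
    by (intro summable_divide summable_err)
qed (use L_pos p_nonneg q_nonneg err_nonneg summable_p summable_q in auto)

text \<open>With the distances bounded, the linear errors become summable, and the decrease term,
  now retained, gives the second conclusion.\<close>

lemma energy_converges:
  assumes z: "z \<in> D" and z_min: "\<And>w. w \<in> D \<Longrightarrow> \<phi> z \<le> \<phi> w"
  shows "convergent (E z)" "summable (\<lambda>k. real k * (\<phi> (xt k) - \<phi> z))"
proof -
  have le: "\<phi> z \<le> \<phi> (xt k)" for k
    by (rule z_min[OF xt_mem])
  obtain M where M: "norm (u k - z) \<le> M" for k
    using bounded_u[OF z z_min] by blast
  then have M0: "M \<ge> 0"
    using norm_ge_zero order_trans by blast
  define r where "r k = (a - 2) / a\<^sup>2 * (real k * (\<phi> (xt k) - \<phi> z))" for k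
  define s where "s k = p k * M + q k * M + err k / a\<^sup>2" for k
  have step: "E z (Suc k) + r k \<le> E z k + s k" for k
  proof -
    have "p k * norm (u (Suc k) - z) \<le> p k * M" "q k * norm (u k - z) \<le> q k * M"
      using M p_nonneg q_nonneg by (auto intro!: mult_left_mono)
    then show ?thesis
      using energy_step[OF z le[of k]] by (simp add: r_def s_def)
  qed
  have pos: "E z k \<ge> 0" "r k \<ge> 0" "s k \<ge> 0" for k
  proof -
    show "E z k \<ge> 0"
      using E_ge[OF le[of k]] L_pos by (smt (verit) half_gt_zero mult_nonneg_nonneg zero_le_power2)
    show "r k \<ge> 0"
      using a_gt le[of k] by (simp add: r_def)
    show "s k \<ge> 0"
      using p_nonneg q_nonneg err_nonneg M0 by (simp add: s_def)
  qed
  have "summable s"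
    unfolding s_def
    by (intro summable_add summable_mult2 summable_divide summable_p summable_q summable_err)
  note conv = convergent_quasi_decreasing[OF step pos this]
  show "convergent (E z)"
    by (rule conv)
  have "summable r"
    by (rule conv)
  then show "summable (\<lambda>k. real k * (\<phi> (xt k) - \<phi> z))"
    unfolding r_def by (rule summable_mult_D) (use a_gt in simp)
qed

section \<open>Velocity estimates and rates\<close>

text \<open>By \<open>u_Suc\<close> each iterate is a convex combination of its predecessor and a
  point \<open>u\<close>, so the iterates stay in the ball containing all \<open>u k\<close>. The
  velocity is then a rescaled difference of two points of that ball.\<close>

lemma scaled_d_bounded:
  assumes M: "\<And>k. norm (u k) \<le> M"
  shows "(real k + a) * norm (d (Suc k)) \<le> a * (2 * M)"
    and "\<bar>real k - 1\<bar> * norm (d k) \<le> a * (2 * M)"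
proof -
  have a0: "a > 0"
    using a_gt by simp
  have xM: "norm (x k) \<le> M" for k
  proof (induction k)
    case 0
    then show ?case
      using M[of 0] by (simp add: u_def d_def)
  next
    case (Suc k)
    define t where "t = a / (real k + a)"
    have t: "0 \<le> t" "t \<le> 1"
      using a0 by (auto simp: t_def)
    have "x (Suc k) = (1 - t) *\<^sub>R x k + t *\<^sub>R u (Suc k)"
    proof -
      have "t *\<^sub>R (u (Suc k) - x k) = d (Suc k)"
        using a0 by (simp add: u_Suc t_def)
      then show ?thesis
        by (simp add: d_def algebra_simps)
    qed
    then have "norm (x (Suc k)) \<le> (1 - t) * norm (x k) + t * norm (u (Suc k))"
      using t norm_triangle_ineq[of "(1 - t) *\<^sub>R x k" "t *\<^sub>R u (Suc k)"] by simp
    also have "\<dots> \<le> M"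
      using t Suc M by (intro convex_bound_le) auto
    finally show ?case .
  qed
  have *: "(real k + a) * norm (d (Suc k)) \<le> a * (2 * M)" for k
  proof -
    have "a *\<^sub>R (u (Suc k) - x k) = (real k + a) *\<^sub>R d (Suc k)"
      using a0 by (simp add: u_Suc)
    then have "norm (a *\<^sub>R (u (Suc k) - x k)) = norm ((real k + a) *\<^sub>R d (Suc k))"
      by (rule arg_cong)
    then have "(real k + a) * norm (d (Suc k)) = a * norm (u (Suc k) - x k)"
      using a0 by simp
    also have "\<dots> \<le> a * (norm (u (Suc k)) + norm (x k))"
      using a0 by (intro mult_left_mono norm_triangle_ineq4) simp
    also have "\<dots> \<le> a * (2 * M)"
      using a0 M[of "Suc k"] xM[of k] by (intro mult_left_mono) auto
    finally show ?thesis .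
  qed
  then show "(real k + a) * norm (d (Suc k)) \<le> a * (2 * M)" .
  show "\<bar>real k - 1\<bar> * norm (d k) \<le> a * (2 * M)"
  proof (cases k)
    \<comment> \<open>The factor is 1 here, but truncated subtraction makes \<open>d 0\<close>
      zero.\<close>
    case 0
    have "M \<ge> 0"
      using M[of 0] norm_ge_zero order_trans by blast
    with 0 a0 show ?thesis
      by (simp add: d_def)
  next
    case (Suc j)
    have "\<bar>real k - 1\<bar> * norm (d k) \<le> (real j + a) * norm (d (Suc j))"
      using a0 Suc by (intro mult_mono) auto
    with *[of j] show ?thesis by simp
  qed
qed

text \<open>At \<open>Suc k\<close> the weight is the square of the denominator in the
  extrapolation, which therefore leaves the coefficient \<open>real k - 1\<close> on
  \<open>d k\<close>.\<close>

definition "G z k = (real k + a - 1)\<^sup>2 * (\<phi> (xt k) - \<phi> z + L / 2 * (norm (d k))\<^sup>2)"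

text \<open>The gain on the left comes from (k + a - 1)^2 - (k - 1)^2 = a (2k + a - 2). The
  coefficient of the gap on the right is the growth of the weight, (k + a)^2 - (k + a - 1)^2 = 2k +
  2a - 1.\<close>

lemma velocity_step:
  assumes M: "\<And>k. norm (u k) \<le> M"
  shows "G z (Suc k) + L / 2 * (a * (2 * real k + a - 2)) * (norm (d k))\<^sup>2
    \<le> G z k + (2 * real k + 2 * a - 1) * (\<phi> (xt k) - \<phi> z)
      + L * (2 * (a * (2 * M))) * ((real k + a) * norm (e k))
      + (a * (2 * M)) * ((real k + a) * norm (\<Delta> k)) + err k"
proof -
  define K where "K = a * (2 * M)"
  define m where "m = real k + a"
  define b where "b = (real k - 1) / m"
  define v v' where "v = \<phi> (xt k) - \<phi> z" and "v' = \<phi> (xt (Suc k)) - \<phi> z"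
  define d' where "d' = d (Suc k)"
  have m0: "m > 0"
    using a_gt by (simp add: m_def)
  have mb: "m * b = real k - 1"
    using m0 by (simp add: b_def)
  have K: "m * norm d' \<le> K" "\<bar>real k - 1\<bar> * norm (d k) \<le> K"
    using scaled_d_bounded[OF M, of k] by (auto simp: K_def m_def d'_def)
  have zy: "xt k - y k = e k - b *\<^sub>R d k"
    by (simp add: extrapolation e_def d_def b_def m_def)
  have zx: "xt k - x (Suc k) = e k - d'"
    by (simp add: e_def d_def d'_def)
  have xz: "xt (Suc k) - xt k = e (Suc k) + d' - e k"
    by (simp add: e_def d_def d'_def)
  have sq: "(norm (xt k - y k))\<^sup>2 - (norm (xt k - x (Suc k)))\<^sup>2 =
      b\<^sup>2 * (norm (d k))\<^sup>2 - (norm d')\<^sup>2 + 2 * (e k \<bullet> (d' - b *\<^sub>R d k))"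
    unfolding zy zx norm_diff_sq
    by (simp add: inner_diff_right power_mult_distrib algebra_simps)
  have "v' \<le> v + L / 2 * (b\<^sup>2 * (norm (d k))\<^sup>2 - (norm d')\<^sup>2 + 2 * (e k \<bullet> (d' - b *\<^sub>R d k)))
      + \<Delta> k \<bullet> (xt (Suc k) - xt k) + (L / 2 * (norm (e (Suc k)))\<^sup>2 + \<epsilon> k)"
    using descent[OF xt_mem[of k], of k] unfolding sq by (simp add: v_def v'_def e_def)
  then have "m\<^sup>2 * v' \<le> m\<^sup>2 * (v + L / 2 * (b\<^sup>2 * (norm (d k))\<^sup>2 - (norm d')\<^sup>2 + 2 * (e k \<bullet> (d' - b *\<^sub>R d k)))
      + \<Delta> k \<bullet> (xt (Suc k) - xt k) + (L / 2 * (norm (e (Suc k)))\<^sup>2 + \<epsilon> k))"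
    by (rule mult_left_mono) simp
  also have "\<dots> = m\<^sup>2 * v + L / 2 * ((m * b)\<^sup>2 * (norm (d k))\<^sup>2) - L / 2 * m\<^sup>2 * (norm d')\<^sup>2
      + L * m * (e k \<bullet> (m *\<^sub>R d' - (m * b) *\<^sub>R d k))
      + m\<^sup>2 * (\<Delta> k \<bullet> (xt (Suc k) - xt k)) + m\<^sup>2 * (L / 2 * (norm (e (Suc k)))\<^sup>2 + \<epsilon> k)"
    by (simp add: power2_eq_square inner_diff_right algebra_simps)
  finally have main: "m\<^sup>2 * v' + L / 2 * m\<^sup>2 * (norm d')\<^sup>2 \<le>
      m\<^sup>2 * v + L / 2 * ((real k - 1)\<^sup>2 * (norm (d k))\<^sup>2)
      + L * m * (e k \<bullet> (m *\<^sub>R d' - (real k - 1) *\<^sub>R d k))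
      + m\<^sup>2 * (\<Delta> k \<bullet> (xt (Suc k) - xt k)) + m\<^sup>2 * (L / 2 * (norm (e (Suc k)))\<^sup>2 + \<epsilon> k)"
    by (simp add: mb)
  \<comment> \<open>One factor \<open>m\<close> goes to the velocities, which are then bounded by
    \<open>K\<close>; the other makes the error summable.\<close>
  have b1: "L * m * (e k \<bullet> (m *\<^sub>R d' - (real k - 1) *\<^sub>R d k)) \<le> L * (2 * K) * (m * norm (e k))"
  proof -
    have "norm (m *\<^sub>R d' - (real k - 1) *\<^sub>R d k) \<le> norm (m *\<^sub>R d') + norm ((real k - 1) *\<^sub>R d k)"
      by (rule norm_triangle_ineq4)
    also have "\<dots> \<le> 2 * K"
      using K m0 by simp
    finally have "e k \<bullet> (m *\<^sub>R d' - (real k - 1) *\<^sub>R d k) \<le> norm (e k) * (2 * K)"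
      by (meson mult_left_mono norm_cauchy_schwarz norm_ge_zero order_trans)
    then have "L * m * (e k \<bullet> (m *\<^sub>R d' - (real k - 1) *\<^sub>R d k)) \<le> L * m * (norm (e k) * (2 * K))"
      using L_pos m0 by (intro mult_left_mono) auto
    then show ?thesis
      by (simp add: algebra_simps)
  qed
  have b2: "m\<^sup>2 * (\<Delta> k \<bullet> (xt (Suc k) - xt k)) \<le>
      m\<^sup>2 * (norm (\<Delta> k) * (norm (e (Suc k)) + norm (e k))) + K * (m * norm (\<Delta> k))"
  proof -
    have "m\<^sup>2 * (\<Delta> k \<bullet> (xt (Suc k) - xt k)) \<le>
        m\<^sup>2 * (norm (\<Delta> k) * (norm (e (Suc k)) + norm d' + norm (e k)))"
      unfolding xz by (intro mult_left_mono norm_inner_le_sum3) simp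
    also have "\<dots> = m\<^sup>2 * (norm (\<Delta> k) * (norm (e (Suc k)) + norm (e k)))
        + (m * norm d') * (m * norm (\<Delta> k))"
      by (simp add: power2_eq_square algebra_simps)
    finally show ?thesis
      using mult_right_mono[OF K(1), of "m * norm (\<Delta> k)"] m0
      by (meson add_left_mono less_imp_le mult_nonneg_nonneg norm_ge_zero order_trans)
  qed
  have Gs: "G z (Suc k) = m\<^sup>2 * v' + L / 2 * m\<^sup>2 * (norm d')\<^sup>2"
    by (simp add: G_def m_def v'_def d'_def algebra_simps)
  have Gk: "G z k + (2 * real k + 2 * a - 1) * v - L / 2 * (a * (2 * real k + a - 2)) * (norm (d k))\<^sup>2
      = m\<^sup>2 * v + L / 2 * ((real k - 1)\<^sup>2 * (norm (d k))\<^sup>2)"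
    by (simp add: G_def m_def v_def power2_eq_square algebra_simps add_divide_distrib diff_divide_distrib)
  have er: "err k = m\<^sup>2 * (norm (\<Delta> k) * (norm (e (Suc k)) + norm (e k)))
      + m\<^sup>2 * (L / 2 * (norm (e (Suc k)))\<^sup>2 + \<epsilon> k)"
    by (simp add: err_def m_def distrib_left)
  show ?thesis
    using main b1 b2 Gk unfolding Gs er v_def[symmetric] K_def[symmetric] m_def[symmetric]
    by linarith
qed

text \<open>The energy estimate makes the gap terms of \<open>velocity_step\<close> summable, so
  \<open>G z\<close> converges and the gain is summable as well. Together they dominate
  \<open>G z k / (real k + 1)\<close>.\<close>

lemma G_tendsto_zero:
  assumes z: "z \<in> D" and z_min: "\<And>w. w \<in> D \<Longrightarrow> \<phi> z \<le> \<phi> w"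
  shows "G z \<longlonglongrightarrow> 0"
proof -
  have le: "\<phi> z \<le> \<phi> (xt k)" for k
    by (rule z_min[OF xt_mem])
  obtain M0 where M0: "norm (u k - z) \<le> M0" for k
    using bounded_u[OF z z_min] by blast
  define M where "M = M0 + norm z"
  have M: "norm (u k) \<le> M" for k
    using M0[of k] norm_triangle_sub[of "u k" z] by (simp add: M_def)
  have "M \<ge> 0"
    using M[of 0] norm_ge_zero order_trans by blast
  define v where "v k = \<phi> (xt k) - \<phi> z" for k
  have v0: "v k \<ge> 0" for k
    using le by (simp add: v_def)
  have sv: "summable (\<lambda>k. real k * v k)"
    unfolding v_def by (rule energy_converges[OF z z_min])
  define r where "r k = L / 2 * (a * (2 * real k + a - 2)) * (norm (d k))\<^sup>2" for k
  define s where "s k = (2 * real k + 2 * a - 1) * v k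
      + L * (2 * (a * (2 * M))) * ((real k + a) * norm (e k))
      + (a * (2 * M)) * ((real k + a) * norm (\<Delta> k)) + err k" for k
  have step: "G z (Suc k) + r k \<le> G z k + s k" for k
    using velocity_step[OF M, of z k] by (simp add: r_def s_def v_def)
  have G0: "G z k \<ge> 0" for k
    using v0[of k] L_pos by (simp add: G_def v_def)
  have r0: "r k \<ge> 0" for k
    using L_pos a_gt by (simp add: r_def)
  have s0: "s k \<ge> 0" for k
    using L_pos a_gt v0[of k] err_nonneg[of k] \<open>M \<ge> 0\<close> by (simp add: s_def)
  \<comment> \<open>This fails at 0, which is why both comparisons below start at 1.\<close>
  have lin: "real k + a - 1 \<le> a * real k" if "k \<ge> 1" for k
  proof -
    have "(a - 1) * (real k - 1) \<ge> 0"
      using that a_gt by simp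
    then show ?thesis
      by (simp add: algebra_simps)
  qed
  have "summable (\<lambda>k. (2 * real k + 2 * a - 1) * v k)"
  proof (rule summable_comparison_test'[where N = 1])
    show "summable (\<lambda>k. (2 * a + 1) * (real k * v k))"
      by (intro summable_mult sv)
    show "norm ((2 * real k + 2 * a - 1) * v k) \<le> (2 * a + 1) * (real k * v k)" if "k \<ge> 1" for k
    proof -
      have "2 * real k + 2 * a - 1 \<le> (2 * a + 1) * real k"
        using lin[OF that] that by (simp add: algebra_simps)
      then have "(2 * real k + 2 * a - 1) * v k \<le> (2 * a + 1) * real k * v k"
        using v0 by (rule mult_right_mono)
      then show ?thesis
        using v0[of k] a_gt by (simp add: abs_mult)
    qed
  qed
  then have "summable s"
    unfolding s_def by (intro summable_add summable_mult summable_e summable_\<Delta> summable_err)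
  note conv = convergent_quasi_decreasing[OF step G0 r0 s0 this]
  show ?thesis
  proof (rule tendsto_zero_if_summable_div[OF conv(1) G0], rule summable_comparison_test'[where N = 1])
    \<comment> \<open>One factor \<open>real k + a - 1\<close> of the weight is cancelled against
      \<open>real k + 1\<close> at the cost of \<open>a\<close>. The other is absorbed into
      \<open>real k\<close> for the gap and into the gain \<open>r k\<close> for the
      velocity.\<close>
    show "summable (\<lambda>k. a * (a * (real k * v k) + r k))"
      by (intro summable_add summable_mult sv conv(2))
    show "norm (G z k / (real k + 1)) \<le> a * (a * (real k * v k) + r k)" if k: "k \<ge> 1" for k
    proof -
      define h where "h = v k + L / 2 * (norm (d k))\<^sup>2"
      have h0: "h \<ge> 0"
        using v0[of k] L_pos by (simp add: h_def)
      have c: "(real k + a - 1) / (real k + 1) \<le> a" "real k + a - 1 \<ge> 0"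
        using lin[OF k] a_gt by (auto simp: field_simps)
      have "G z k / (real k + 1) = (real k + a - 1) / (real k + 1) * ((real k + a - 1) * h)"
        by (simp add: G_def h_def v_def power2_eq_square)
      also have "\<dots> \<le> a * ((real k + a - 1) * h)"
        using c h0 by (intro mult_right_mono) auto
      also have "(real k + a - 1) * h \<le> a * (real k * v k) + r k"
      proof -
        have "(real k + a - 1) * v k \<le> a * real k * v k"
          using lin[OF k] v0 by (rule mult_right_mono)
        moreover have "(real k + a - 1) * (L / 2 * (norm (d k))\<^sup>2) \<le> a * (2 * real k + a - 2) * (L / 2 * (norm (d k))\<^sup>2)"
        proof (rule mult_right_mono)
          have "real k + a - 1 \<le> a * real k"
            by (rule lin[OF k])
          also have "\<dots> \<le> a * (2 * real k + a - 2)"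
            using a_gt by (intro mult_left_mono) auto
          finally show "real k + a - 1 \<le> a * (2 * real k + a - 2)" .
        qed (use L_pos in simp)
        moreover have "r k = a * (2 * real k + a - 2) * (L / 2 * (norm (d k))\<^sup>2)"
          by (simp add: r_def)
        ultimately show ?thesis
          unfolding h_def distrib_left by (simp add: mult.assoc)
      qed
      finally show ?thesis
        using a_gt G0[of k] by (simp add: mult_left_mono)
    qed
  qed
qed

text \<open>Both parts of \<open>G\<close> are nonnegative, so each is dominated by
  \<open>G\<close>; the velocity bound follows after a square root.\<close>

lemma rates:
  assumes z: "z \<in> D" and z_min: "\<And>w. w \<in> D \<Longrightarrow> \<phi> z \<le> \<phi> w"
  shows "(\<lambda>k. (real k + a - 1)\<^sup>2 * (\<phi> (xt k) - \<phi> z)) \<longlonglongrightarrow> 0"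
    and "(\<lambda>k. real k * norm (d k)) \<longlonglongrightarrow> 0"
proof -
  have le: "\<phi> z \<le> \<phi> (xt k)" for k
    by (rule z_min[OF xt_mem])
  note G = G_tendsto_zero[OF z z_min]
  show "(\<lambda>k. (real k + a - 1)\<^sup>2 * (\<phi> (xt k) - \<phi> z)) \<longlonglongrightarrow> 0"
  proof (rule tendsto_zero_squeeze[OF _ _ G])
    show "0 \<le> (real k + a - 1)\<^sup>2 * (\<phi> (xt k) - \<phi> z)" for k
      using le by simp
    show "(real k + a - 1)\<^sup>2 * (\<phi> (xt k) - \<phi> z) \<le> G z k" for k
      unfolding G_def using L_pos by (intro mult_left_mono) auto
  qed
  have "(\<lambda>k. sqrt (2 / L * G z k)) \<longlonglongrightarrow> sqrt (2 / L * 0)"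
    by (intro tendsto_intros G)
  then have sq: "(\<lambda>k. sqrt (2 / L * G z k)) \<longlonglongrightarrow> 0"
    by simp
  show "(\<lambda>k. real k * norm (d k)) \<longlonglongrightarrow> 0"
  proof (rule tendsto_zero_squeeze[OF _ _ sq])
    show "real k * norm (d k) \<le> sqrt (2 / L * G z k)" for k
    proof (rule real_le_rsqrt)
      have "L / 2 * (real k * norm (d k))\<^sup>2 = (real k)\<^sup>2 * (L / 2 * (norm (d k))\<^sup>2)"
        by (simp add: power_mult_distrib)
      also have "\<dots> \<le> (real k + a - 1)\<^sup>2 * (L / 2 * (norm (d k))\<^sup>2)"
        using a_gt L_pos by (intro mult_right_mono power_mono) auto
      also have "\<dots> \<le> G z k"
        unfolding G_def using le[of k] by (intro mult_left_mono) auto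
      finally show "(real k * norm (d k))\<^sup>2 \<le> 2 / L * G z k"
        using L_pos by (simp add: field_simps)
    qed
  qed simp
qed

text \<open>Since \<open>u k - x k\<close> tends to zero, the distances of \<open>x k\<close> to a minimizer inherit
  convergence from the energy.\<close>

lemma distance_converges:
  assumes z: "z \<in> D" and z_min: "\<And>w. w \<in> D \<Longrightarrow> \<phi> z \<le> \<phi> w"
  shows "convergent (\<lambda>k. norm (x k - z))"
proof -
  obtain l where l: "E z \<longlonglongrightarrow> l"
    using energy_converges(1)[OF z z_min] by (auto simp: convergent_def)
  \<comment> \<open>This expression is the definition of \<open>E\<close> solved for
    \<open>norm (u k - z)\<close>; its gap part vanishes in the limit.\<close>
  have "(\<lambda>k. sqrt (2 / L * (E z k - (real k + a - 1)\<^sup>2 * (\<phi> (xt k) - \<phi> z) / a\<^sup>2)))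
      \<longlonglongrightarrow> sqrt (2 / L * (l - 0 / a\<^sup>2))"
    using a_gt by (intro tendsto_intros l rates[OF z z_min]) auto
  moreover have "sqrt (2 / L * (E z k - (real k + a - 1)\<^sup>2 * (\<phi> (xt k) - \<phi> z) / a\<^sup>2)) = norm (u k - z)" for k
  proof -
    have *: "E z k - (real k + a - 1)\<^sup>2 * (\<phi> (xt k) - \<phi> z) / a\<^sup>2 = L / 2 * (norm (u k - z))\<^sup>2"
      by (simp add: E_def power_divide algebra_simps)
    show ?thesis
      unfolding * using L_pos by simp
  qed
  ultimately have u: "(\<lambda>k. norm (u k - z)) \<longlonglongrightarrow> sqrt (2 / L * l)"
    by simp
  have "(\<lambda>k. real k * norm (d k) / a) \<longlonglongrightarrow> 0 / a"
    using a_gt by (intro tendsto_intros rates[OF z z_min]) auto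
  then have dl: "(\<lambda>k. real k * norm (d k) / a) \<longlonglongrightarrow> 0"
    by simp
  have "(\<lambda>k. norm (x k - z) - norm (u k - z)) \<longlonglongrightarrow> 0"
  proof (rule Lim_null_comparison[OF always_eventually, OF allI dl])
    fix k
    have "norm (norm (x k - z) - norm (u k - z)) \<le> norm (x k - u k)"
      using norm_triangle_ineq3[of "x k - z" "u k - z"] by simp
    also have "\<dots> = \<bar>real k - 1\<bar> * norm (d k) / a"
      using a_gt by (simp add: u_def)
    also have "\<dots> \<le> real k * norm (d k) / a"
    \<comment> \<open>For \<open>k = 0\<close> the factor on the left exceeds the one on the right,
      and \<open>d 0 = 0\<close> is needed.\<close>
    proof (cases "k = 0")
      case False
      then show ?thesis
        using a_gt by (intro divide_right_mono mult_right_mono) auto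
    qed (simp add: d_def)
    finally show "norm (norm (x k - z) - norm (u k - z)) \<le> real k * norm (d k) / a" .
  qed
  from tendsto_add[OF this u] show ?thesis
    by (auto simp: convergent_def)
qed

section \<open>Convergence of the iterates\<close>

lemma e_tendsto_zero: "e \<longlonglongrightarrow> 0"
proof (rule Lim_null_comparison[OF always_eventually, OF allI summable_LIMSEQ_zero[OF summable_e]])
  show "norm (e k) \<le> (real k + a) * norm (e k)" for k
    using a_gt by (simp add: mult_le_cancel_right1)
qed

lemma values_tendsto:
  assumes z: "z \<in> D" and z_min: "\<And>w. w \<in> D \<Longrightarrow> \<phi> z \<le> \<phi> w"
  shows "(\<lambda>k. \<phi> (xt k)) \<longlonglongrightarrow> \<phi> z"
proof -
  have "(\<lambda>k. \<phi> (xt k) - \<phi> z) \<longlonglongrightarrow> 0"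
  proof (rule tendsto_zero_squeeze[OF _ _ rates(1)[OF z z_min]])
    fix k
    show nn: "0 \<le> \<phi> (xt k) - \<phi> z"
      using z_min[OF xt_mem] by simp
    have "1 \<le> (real k + a - 1)\<^sup>2"
      using a_gt by simp
    from mult_right_mono[OF this nn]
    show "\<phi> (xt k) - \<phi> z \<le> (real k + a - 1)\<^sup>2 * (\<phi> (xt k) - \<phi> z)"
      by simp
  qed
  then show ?thesis
    by (rule LIM_zero_cancel)
qed

text \<open>A subsequential limit \<open>w\<close> is a minimizer by \<open>lsc\<close>, so the
  distances to \<open>w\<close> itself converge, and along the subsequence they tend to zero.
  Membership in \<open>D\<close> is part of \<open>lsc\<close> because the real-valued
  \<open>\<phi>\<close> cannot record infinite values.\<close>

lemma iterates_converge:
  assumes z: "z \<in> D" and z_min: "\<And>w. w \<in> D \<Longrightarrow> \<phi> z \<le> \<phi> w"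
    and lsc: "\<And>X w l. (\<And>n. X n \<in> D) \<Longrightarrow> X \<longlonglongrightarrow> w \<Longrightarrow> (\<lambda>n. \<phi> (X n)) \<longlonglongrightarrow> l \<Longrightarrow> w \<in> D \<and> \<phi> w \<le> l"
  obtains w where "w \<in> D" "\<phi> w \<le> \<phi> z" "x \<longlonglongrightarrow> w" "xt \<longlonglongrightarrow> w"
proof -
  have "Bseq (\<lambda>k. norm (x k - z))"
    by (rule convergent_imp_Bseq[OF distance_converges[OF z z_min]])
  then obtain K where K: "\<And>k. norm (x k - z) \<le> K"
    by (auto simp: Bseq_def)
  have "bounded (range x)"
    unfolding bounded_any_center[of _ z] using K by (auto simp: dist_norm norm_minus_commute)
  then obtain w r where r: "strict_mono r" and w: "(x \<circ> r) \<longlonglongrightarrow> w"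
    using bounded_imp_convergent_subsequence by blast
  have "(e \<circ> r) \<longlonglongrightarrow> 0"
    by (rule LIMSEQ_subseq_LIMSEQ[OF e_tendsto_zero r])
  from tendsto_add[OF w this] have "(\<lambda>n. xt (r n)) \<longlonglongrightarrow> w"
    by (simp add: e_def)
  moreover have "(\<lambda>n. \<phi> (xt (r n))) \<longlonglongrightarrow> \<phi> z"
    using LIMSEQ_subseq_LIMSEQ[OF values_tendsto[OF z z_min] r] by (simp add: o_def)
  ultimately have wD: "w \<in> D" "\<phi> w \<le> \<phi> z"
    using lsc[of "\<lambda>n. xt (r n)"] xt_mem by auto
  have "convergent (\<lambda>k. norm (x k - w))"
    using wD z_min by (intro distance_converges) (auto intro: order_trans)
  then obtain l where l: "(\<lambda>k. norm (x k - w)) \<longlonglongrightarrow> l"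
    by (auto simp: convergent_def)
  have "(\<lambda>k. norm (x (r k) - w)) \<longlonglongrightarrow> l"
    using LIMSEQ_subseq_LIMSEQ[OF l r] by (simp add: o_def)
  moreover have "(\<lambda>k. norm (x (r k) - w)) \<longlonglongrightarrow> 0"
    using w by (simp add: o_def tendsto_norm_zero LIM_zero)
  ultimately have "l = 0"
    by (rule LIMSEQ_unique)
  with l have "(\<lambda>k. x k - w) \<longlonglongrightarrow> 0"
    by (simp add: tendsto_norm_zero_iff)
  then have x: "x \<longlonglongrightarrow> w"
    by (rule LIM_zero_cancel)
  from tendsto_add[OF this e_tendsto_zero] have "xt \<longlonglongrightarrow> w"
    by (simp add: e_def)
  with wD x show ?thesis
    by (rule that)
qed

end

section \<open>Extended-valued functions and one inexact proximal gradient step\<close>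

lemma proper_fun_real:
  assumes "proper_fun P" and "z \<in> effective_domain P"
  shows "P z = ereal (real_of_ereal (P z))"
  using assms by (cases "P z") (auto simp: proper_fun_def effective_domain_def)

text \<open>A convex combination of two graph points stays in the epigraph, which gives finiteness
  at the combined point together with the inequality.\<close>

lemma convex_on_real_of_proper_fun:
  assumes P: "proper_fun P" and conv: "convex_fun P"
  shows "convex_on (effective_domain P) (\<lambda>z. real_of_ereal (P z))"
proof -
  define p where "p z = real_of_ereal (P z)" for z
  have key: "P (r *\<^sub>R z + s *\<^sub>R w) \<le> ereal (r * p z + s * p w)"
    if "z \<in> effective_domain P" "w \<in> effective_domain P" "r \<ge> 0" "s \<ge> 0" "r + s = 1" for z w r s
  proof -
    have "(z, p z) \<in> ereal_epigraph P" "(w, p w) \<in> ereal_epigraph P"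
      using that proper_fun_real[OF P] by (simp_all add: ereal_epigraph_def p_def)
    then have "r *\<^sub>R (z, p z) + s *\<^sub>R (w, p w) \<in> ereal_epigraph P"
      using conv that unfolding convex_fun_def by (intro convexD)
    then show ?thesis
      by (simp add: ereal_epigraph_def)
  qed
  have dom: "r *\<^sub>R z + s *\<^sub>R w \<in> effective_domain P"
    if "z \<in> effective_domain P" "w \<in> effective_domain P" "r \<ge> 0" "s \<ge> 0" "r + s = 1" for z w r s
  proof -
    have "P (r *\<^sub>R z + s *\<^sub>R w) < \<infinity>"
      using key[OF that] by (rule order.strict_trans1) simp
    then show ?thesis
      by (simp add: effective_domain_def)
  qed
  have "p (r *\<^sub>R z + s *\<^sub>R w) \<le> r * p z + s * p w"
    if "z \<in> effective_domain P" "w \<in> effective_domain P" "r \<ge> 0" "s \<ge> 0" "r + s = 1" for z w r s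
  proof -
    have "ereal (p (r *\<^sub>R z + s *\<^sub>R w)) = P (r *\<^sub>R z + s *\<^sub>R w)"
      unfolding p_def using proper_fun_real[OF P dom[OF that]] by simp
    then show ?thesis
      using key[OF that] by (metis ereal_less_eq(3))
  qed
  with dom show ?thesis
    unfolding convex_on_def convex_def p_def by blast
qed

lemma lower_semicontinuous_on_domain:
  fixes P :: "'a::metric_space \<Rightarrow> ereal"
  assumes P: "proper_fun P" and closed: "closed_fun P"
    and X: "\<And>n. X n \<in> effective_domain P" "X \<longlonglongrightarrow> w"
    and l: "(\<lambda>n. real_of_ereal (P (X n))) \<longlonglongrightarrow> l"
  shows "P w \<le> ereal l"
proof -
  have mem: "(X n, real_of_ereal (P (X n))) \<in> ereal_epigraph P" for n
    using proper_fun_real[OF P X(1)[of n]] by (simp add: ereal_epigraph_def)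
  have lim: "(\<lambda>n. (X n, real_of_ereal (P (X n)))) \<longlonglongrightarrow> (w, l)"
    by (intro tendsto_Pair X l)
  have "(w, l) \<in> ereal_epigraph P"
    using closed_sequentially[OF _ mem lim] closed by (simp add: closed_fun_def)
  then show ?thesis
    by (simp add: ereal_epigraph_def)
qed

text \<open>Three inequalities are added: the \<epsilon>-subgradient at \<open>xt\<close> tested at
  \<open>z\<close>, the quadratic upper bound of \<open>f\<close> from \<open>y\<close> to
  \<open>xt\<close>, and its tangent lower bound from \<open>y\<close> to \<open>z\<close>.\<close>

lemma inexact_prox_gradient_descent:
  fixes f :: "'a::real_inner \<Rightarrow> real"
  assumes P: "proper_fun P"
    and f_convex: "convex_on UNIV f" and f_gradient: "\<And>z. GDERIV f z :> g z"
    and lip: "\<And>u v. norm (g u - g v) \<le> L * norm (u - v)"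
    and xt: "xt \<in> effective_domain P" and z: "z \<in> effective_domain P"
    and b: "b \<in> eps_subdifferential P \<epsilon> xt" and \<Delta>: "\<Delta> = b + g y + L *\<^sub>R (x - y)"
  shows "(real_of_ereal (P xt) + f xt) - (real_of_ereal (P z) + f z) \<le>
    L / 2 * ((norm (z - y))\<^sup>2 - (norm (z - x))\<^sup>2) + \<Delta> \<bullet> (xt - z)
      + L / 2 * (norm (xt - x))\<^sup>2 + \<epsilon>"
proof -
  have "P z \<ge> P xt + ereal (b \<bullet> (z - xt)) - ereal \<epsilon>"
    using b by (simp add: eps_subdifferential_def)
  moreover obtain r s where "P xt = ereal r" "P z = ereal s"
    using proper_fun_real[OF P xt] proper_fun_real[OF P z] by blast
  ultimately have "real_of_ereal (P xt) + b \<bullet> (z - xt) - \<epsilon> \<le> real_of_ereal (P z)"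
    by simp
  moreover have "f xt \<le> f y + g y \<bullet> (xt - y) + L / 2 * (norm (xt - y))\<^sup>2"
    using f_gradient lip by (rule descent_lemma)
  moreover have "f z \<ge> f y + g y \<bullet> (z - y)"
    using f_convex f_gradient by (rule convex_above_gradient)
  ultimately have "(real_of_ereal (P xt) + f xt) - (real_of_ereal (P z) + f z) \<le>
      b \<bullet> (xt - z) + g y \<bullet> (xt - z) + L / 2 * (norm (xt - y))\<^sup>2 + \<epsilon>"
    by (simp add: inner_diff_right)
  also have "b \<bullet> (xt - z) + g y \<bullet> (xt - z) = \<Delta> \<bullet> (xt - z) - L * ((x - y) \<bullet> (xt - z))"
    by (simp add: \<Delta> inner_add_left)
  also have "\<dots> + L / 2 * (norm (xt - y))\<^sup>2 = \<Delta> \<bullet> (xt - z)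
      + L / 2 * ((norm (xt - y))\<^sup>2 - 2 * ((x - y) \<bullet> (xt - z)))"
    by (simp add: right_diff_distrib)
  \<comment> \<open>A four-point identity; for \<open>xt = x\<close> it is the usual three-point
    identity, so the last square is the price of the two different points.\<close>
  also have "(norm (xt - y))\<^sup>2 - 2 * ((x - y) \<bullet> (xt - z)) =
      (norm (z - y))\<^sup>2 - (norm (z - x))\<^sup>2 + (norm (xt - x))\<^sup>2"
    by (simp add: power2_norm_eq_inner inner_diff_left inner_diff_right inner_commute)
  finally show ?thesis
    by (simp add: distrib_left)
qed

section \<open>Application to SpinAPG\<close>

theorem theorem3p2:
  fixes P :: "'a::euclidean_space \<Rightarrow> ereal"
    and f :: "'a \<Rightarrow> real"
    and g :: "'a \<Rightarrow> 'a"
    and F :: "'a \<Rightarrow> ereal"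
    and Fstar :: ereal
    and L \<alpha> :: real
    and \<theta> \<eta> \<mu> \<nu> :: "nat \<Rightarrow> real"
    and x xt :: "nat \<Rightarrow> 'a"
  assumes P: "proper_fun P" "closed_fun P" "convex_fun P"
    and f_convex: "convex_on UNIV f"
    and f_gradient: "\<And>z. GDERIV f z :> g z"
    and g_continuous: "continuous_on UNIV g"
    and L_pos: "L > 0"
    and g_lipschitz: "\<And>u v. norm (g u - g v) \<le> L * norm (u - v)"
    and F: "F = (\<lambda>z. P z + ereal (f z))"
    and minimizer_exists: "minimizers F \<noteq> {}"
    and Fstar: "Fstar = (INF z. F z)"
    and alpha: "\<alpha> > 3"
    and theta_0: "\<theta> 0 = 1"
    and theta: "\<And>k. k \<ge> 1 \<Longrightarrow> \<theta> k = (\<alpha> - 1) / (real k + \<alpha> - 1)"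
    and eta_summable: "summable (\<lambda>k. inverse (\<theta> k) * \<eta> k)"
    and mu_summable: "summable (\<lambda>k. inverse (\<theta> k) * \<mu> k)"
    and nu_summable: "summable (\<lambda>k. inverse (\<theta> k ^ 2) * \<nu> k)"
    and generated: "spinapg_generated P g L \<theta> \<eta> \<mu> \<nu> x xt"
  shows "((\<lambda>k. ereal ((real k)\<^sup>2) * (F (xt k) - Fstar)) \<longlonglongrightarrow> 0 \<and>
          (\<lambda>k. real k * norm (x k - x (k - 1))) \<longlonglongrightarrow> 0) \<and>
         (bounded (range x) \<and> bounded (range xt) \<and>
          (\<forall>z. cluster_point x z \<or> cluster_point xt z \<longrightarrow> z \<in> minimizers F)) \<and>
         (\<exists>z\<in>minimizers F. x \<longlonglongrightarrow> z \<and> xt \<longlonglongrightarrow> z)"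
proof -
  define D where "D = effective_domain P"
  define \<phi> where "\<phi> z = real_of_ereal (P z) + f z" for z
  define a where "a = \<alpha> - 1"
  have a: "a > 2"
    using alpha by (simp add: a_def)
  have F_D: "F z = ereal (\<phi> z)" if "z \<in> D" for z
    using proper_fun_real[OF P(1)] that unfolding F \<phi>_def D_def by (metis plus_ereal.simps(1))
  have F_notD: "F z = \<infinity>" if "z \<notin> D" for z
    using that by (simp add: F D_def effective_domain_def)
  \<comment> \<open>Properness provides a finite value, so no minimizer lies outside
    \<open>D\<close> and the problem becomes real-valued.\<close>
  have min_iff: "z \<in> minimizers F \<longleftrightarrow> z \<in> D \<and> (\<forall>w\<in>D. \<phi> z \<le> \<phi> w)" for z
  proof
    assume "z \<in> minimizers F"
    then have le: "F z \<le> F w" for w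
      by (simp add: minimizers_def is_arg_min_def not_less)
    obtain w0 where "w0 \<in> D"
      using P(1) by (auto simp: proper_fun_def D_def)
    have z: "z \<in> D"
    proof (rule ccontr)
      assume "z \<notin> D"
      with le[of w0] F_notD F_D[OF \<open>w0 \<in> D\<close>] show False by simp
    qed
    moreover have "\<phi> z \<le> \<phi> w" if "w \<in> D" for w
      using le[of w] F_D[OF z] F_D[OF that] by simp
    ultimately show "z \<in> D \<and> (\<forall>w\<in>D. \<phi> z \<le> \<phi> w)" by blast
  next
    assume "z \<in> D \<and> (\<forall>w\<in>D. \<phi> z \<le> \<phi> w)"
    then have "F z \<le> F w" for w
      using F_D F_notD by (cases "w \<in> D") auto
    then show "z \<in> minimizers F"
      by (simp add: minimizers_def is_arg_min_def not_less)
  qed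
  obtain z where z: "z \<in> minimizers F"
    using minimizer_exists by blast
  then have zD: "z \<in> D" and z_min: "\<And>w. w \<in> D \<Longrightarrow> \<phi> z \<le> \<phi> w"
    using min_iff by auto
  have Fstar_eq: "Fstar = ereal (\<phi> z)"
    unfolding Fstar F_D[OF zD, symmetric]
    using z by (intro antisym INF_lower INF_greatest) (auto simp: minimizers_def is_arg_min_def not_less)

  from generated obtain y \<Delta> \<epsilon> where gen: "\<And>k.
        y k = x k + (\<theta> k * (inverse (\<theta> (k - 1)) - 1)) *\<^sub>R (x k - x (k - 1)) \<and>
        xt (Suc k) \<in> effective_domain P \<and>
        \<epsilon> k \<ge> 0 \<and>
        \<Delta> k \<in> (\<lambda>d. d + g (y k) + L *\<^sub>R (x (Suc k) - y k)) `
                 eps_subdifferential P (\<epsilon> k) (xt (Suc k)) \<and>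
        norm (\<Delta> k) \<le> \<eta> k \<and>
        \<epsilon> k \<le> \<nu> k \<and>
        norm (xt (Suc k) - x (Suc k)) \<le> \<mu> k"
    and xt0: "xt 0 \<in> effective_domain P"
    unfolding spinapg_generated_def by blast
  have xtD: "xt k \<in> D" for k
    using xt0 gen by (cases k) (auto simp: D_def)
  have th: "\<theta> k = a / (real k + a)" for k
    using theta_0 theta[of k] a by (cases "k = 0") (auto simp: a_def add_diff_eq)
  have inv_th: "inverse (\<theta> k) = (real k + a) / a" for k
    by (simp add: th)

  interpret inexact_apg \<phi> D L a \<epsilon> \<Delta> x xt y
  proof
    show "convex_on D \<phi>"
      unfolding \<phi>_def D_def using convex_on_real_of_proper_fun[OF P(1,3)]
      by (intro convex_on_add convex_on_subset[OF f_convex]) (auto simp: convex_on_def)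
    show "L > 0" "a > 2"
      by (fact L_pos a)+
    show "xt k \<in> D" "\<epsilon> k \<ge> 0" for k
      using xtD gen by auto
    show "y k = x k + ((real k - 1) / (real k + a)) *\<^sub>R (x k - x (k - 1))" for k
    proof (cases "k = 0")
      \<comment> \<open>The coefficients differ, being 0 and \<open>- 1 / a\<close>, but both
        multiply \<open>x 0 - x 0\<close>.\<close>
      case True
      then show ?thesis using gen[of 0] by simp
    next
      case False
      have "inverse (\<theta> (k - 1)) - 1 = (real k - 1) / a"
        unfolding inv_th using False a by (simp add: of_nat_diff field_simps)
      then have "\<theta> k * (inverse (\<theta> (k - 1)) - 1) = (real k - 1) / (real k + a)"
        using a by (simp add: th)
      then show ?thesis
        using gen[of k] by simp
    qed
    show "\<phi> (xt (Suc k)) - \<phi> w \<le>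
        L / 2 * ((norm (w - y k))\<^sup>2 - (norm (w - x (Suc k)))\<^sup>2) + \<Delta> k \<bullet> (xt (Suc k) - w)
        + L / 2 * (norm (xt (Suc k) - x (Suc k)))\<^sup>2 + \<epsilon> k" if "w \<in> D" for w k
    proof -
      obtain b where b: "b \<in> eps_subdifferential P (\<epsilon> k) (xt (Suc k))"
        "\<Delta> k = b + g (y k) + L *\<^sub>R (x (Suc k) - y k)"
        using gen[of k] by blast
      show ?thesis
        unfolding \<phi>_def using that xtD
        by (intro inexact_prox_gradient_descent[OF P(1) f_convex f_gradient g_lipschitz _ _ b])
          (auto simp: D_def)
    qed
    show "summable (\<lambda>k. (real k + a) * norm (\<Delta> k))"
    proof (rule summable_comparison_test'[OF summable_mult[OF eta_summable, of a], of 0])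
      show "norm ((real k + a) * norm (\<Delta> k)) \<le> a * (inverse (\<theta> k) * \<eta> k)" for k
        using gen[of k] a by (simp add: inv_th abs_mult mult_left_mono)
    qed
    show "summable (\<lambda>k. (real k + a)\<^sup>2 * \<epsilon> k)"
    proof (rule summable_comparison_test'[OF summable_mult[OF nu_summable, of "a\<^sup>2"], of 0])
      show "norm ((real k + a)\<^sup>2 * \<epsilon> k) \<le> a\<^sup>2 * (inverse ((\<theta> k)\<^sup>2) * \<nu> k)" for k
        using gen[of k] a by (simp add: th power_divide abs_mult mult_left_mono)
    qed
    \<comment> \<open>The tolerance \<open>\<mu> k\<close> controls the error at
      \<open>Suc k\<close>. The factor 2 below pays for the shifted weight, since k + 1 + a is at
      most 2 (k + a).\<close>
    have "summable (\<lambda>k. (real (Suc k) + a) * norm (xt (Suc k) - x (Suc k)))"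
    proof (rule summable_comparison_test'[OF summable_mult[OF mu_summable, of "2 * a"], of 0])
      fix k
      have "(real (Suc k) + a) * norm (xt (Suc k) - x (Suc k)) \<le> (2 * a * ((real k + a) / a)) * \<mu> k"
        using gen[of k] a by (intro mult_mono) auto
      then show "norm ((real (Suc k) + a) * norm (xt (Suc k) - x (Suc k))) \<le> 2 * a * (inverse (\<theta> k) * \<mu> k)"
        unfolding inv_th mult.assoc using a by (simp only: real_norm_def abs_mult) simp
    qed
    then show "summable (\<lambda>k. (real k + a) * norm (xt k - x k))"
      by (subst (asm) summable_Suc_iff)
  qed

  have value_rate: "(\<lambda>k. ereal ((real k)\<^sup>2) * (F (xt k) - Fstar)) \<longlonglongrightarrow> 0"
  proof -
    have lim: "(\<lambda>k. (real k)\<^sup>2 * (\<phi> (xt k) - \<phi> z)) \<longlonglongrightarrow> 0"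
    proof (rule tendsto_zero_squeeze[OF _ _ rates(1)[OF zD z_min]])
      show "0 \<le> (real k)\<^sup>2 * (\<phi> (xt k) - \<phi> z)"
        "(real k)\<^sup>2 * (\<phi> (xt k) - \<phi> z) \<le> (real k + a - 1)\<^sup>2 * (\<phi> (xt k) - \<phi> z)" for k
        using z_min[OF xtD[of k]] a by (auto intro!: mult_right_mono power_mono)
    qed
    have eq: "ereal ((real k)\<^sup>2) * (F (xt k) - Fstar) = ereal ((real k)\<^sup>2 * (\<phi> (xt k) - \<phi> z))" for k
      by (simp add: F_D xtD Fstar_eq)
    show ?thesis
      unfolding eq zero_ereal_def by (rule tendsto_ereal[OF lim])
  qed
  have step_rate: "(\<lambda>k. real k * norm (x k - x (k - 1))) \<longlonglongrightarrow> 0"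
    using rates(2)[OF zD z_min] by (simp add: d_def)
  obtain w where w: "w \<in> D" "\<phi> w \<le> \<phi> z" and lim: "x \<longlonglongrightarrow> w" "xt \<longlonglongrightarrow> w"
  proof (rule iterates_converge[OF zD z_min])
    fix X v l assume X: "\<And>n. X n \<in> D" "X \<longlonglongrightarrow> v" and l: "(\<lambda>n. \<phi> (X n)) \<longlonglongrightarrow> l"
    \<comment> \<open>Continuity of \<open>f\<close> separates the limit of the
      \<open>P\<close>-values from that of \<open>\<phi>\<close>, so closedness of \<open>P\<close>
      applies; the finite bound then puts \<open>v\<close> in the domain.\<close>
    have "isCont f v"
      using f_gradient[of v] unfolding gderiv_def by (rule has_derivative_continuous)
    then have "(\<lambda>n. f (X n)) \<longlonglongrightarrow> f v"
      using X(2) by (rule isCont_tendsto_compose)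
    from tendsto_diff[OF l this] have "(\<lambda>n. real_of_ereal (P (X n))) \<longlonglongrightarrow> l - f v"
      by (simp add: \<phi>_def)
    then have Pv: "P v \<le> ereal (l - f v)"
      using X by (intro lower_semicontinuous_on_domain[OF P(1,2)]) (auto simp: D_def)
    then have vD: "v \<in> D"
      by (auto simp: D_def effective_domain_def)
    have "real_of_ereal (P v) \<le> l - f v"
      using Pv proper_fun_real[OF P(1), of v] vD unfolding D_def by (metis ereal_less_eq(3))
    then show "v \<in> D \<and> \<phi> v \<le> l"
      using vD by (simp add: \<phi>_def)
  qed
  have w_min: "w \<in> minimizers F"
    using w z_min by (auto simp: min_iff intro: order_trans)
  \<comment> \<open>The cluster point and boundedness claims follow from convergence of the whole
    sequences.\<close>
  have "v = w" if "cluster_point x v \<or> cluster_point xt v" for v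
    using that lim by (auto simp: cluster_point_def dest: LIMSEQ_subseq_LIMSEQ LIMSEQ_unique)
  with w_min have "\<forall>v. cluster_point x v \<or> cluster_point xt v \<longrightarrow> v \<in> minimizers F"
    by blast
  moreover have "bounded (range x)" "bounded (range xt)"
    using lim by (auto intro: convergent_imp_bounded)
  ultimately show ?thesis
    using value_rate step_rate w_min lim by blast
qed

end
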